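(* Let $U$ be a set, $E$ a finite set, and $G=(F,E)$ a covering soft set over $U$, with associated soft covering approximation space $S=(U,C_G)$. Then the following are equivalent: (i) $S^-(X\cup Y)=S^-(X)\cup S^-(Y)$ for all $X,Y\subseteq U$; (ii) for all $e_1,e_2\in E$, the set $F(e_1)\cap F(e_2)$ is a finite union of elements of $C_G$.
   Context: A soft set over $U$ is a pair $G=(F,E)$ with $F:E\to P(U)$ a map into the power set of $U$. It is a covering soft set if $\bigcup_{e\in E}F(e)=U$ and $F(e)\neq\emptyset$ for every $e\in E$. Write $C_G=\{F(e):e\in E\}$; the pair $S=(U,C_G)$ is called a soft covering approximation space. For $x\in U$ the soft minimal description of $x$ is $Md_S(x)=\{F(e): e\in E,\ x\in F(e),\text{ and for all } a\in E,\ x\in F(a)\subseteq F(e)\text{ implies }F(a)=F(e)\}$, i.e. the family of inclusion-minimal members of $C_G$ containing $x$. For $X\subseteq U$ the soft covering lower approximation is $S_-(X)=\bigcup\{F(e): e\in E,\ F(e)\subseteq X\}$ and the soft covering upper approximation is $S^-(X)=S_-(X)\cup\bigcup_{x\in X\setminus S_-(X)}\ \bigcup_{K\in Md_S(x)}K$. The empty union (equal to $\emptyset$) counts as a finite union of elements of $C_G$. *)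

theory Defs
  imports Main "HOL-Library.FuncSet"
begin

text \<open>
  A soft set \<open>G = (F, E)\<close> over \<open>U\<close> is given by its two components; only the values of \<open>F\<close>
  on \<open>E\<close> matter. The description and the approximations below depend on \<open>G\<close> alone, so
  they do not take the universe \<open>U\<close> as an argument.
\<close>

definition soft_set :: "'a set \<Rightarrow> ('e \<Rightarrow> 'a set) \<Rightarrow> 'e set \<Rightarrow> bool" where
  "soft_set U F E \<longleftrightarrow> F \<in> E \<rightarrow> Pow U"

definition covering_soft_set :: "'a set \<Rightarrow> ('e \<Rightarrow> 'a set) \<Rightarrow> 'e set \<Rightarrow> bool" where
  "covering_soft_set U F E \<longleftrightarrow>
     soft_set U F E \<and> (\<Union>e\<in>E. F e) = U \<and> (\<forall>e\<in>E. F e \<noteq> {})"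

definition soft_cover :: "('e \<Rightarrow> 'a set) \<Rightarrow> 'e set \<Rightarrow> 'a set set" where
  "soft_cover F E = {F e | e. e \<in> E}"

definition soft_Md :: "('e \<Rightarrow> 'a set) \<Rightarrow> 'e set \<Rightarrow> 'a \<Rightarrow> 'a set set" where
  "soft_Md F E x =
     {F e | e. e \<in> E \<and> x \<in> F e \<and> (\<forall>a\<in>E. x \<in> F a \<and> F a \<subseteq> F e \<longrightarrow> F a = F e)}"

definition soft_lower :: "('e \<Rightarrow> 'a set) \<Rightarrow> 'e set \<Rightarrow> 'a set \<Rightarrow> 'a set" where
  "soft_lower F E X = \<Union>{F e | e. e \<in> E \<and> F e \<subseteq> X}"

definition soft_upper :: "('e \<Rightarrow> 'a set) \<Rightarrow> 'e set \<Rightarrow> 'a set \<Rightarrow> 'a set" where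
  "soft_upper F E X =
     soft_lower F E X \<union> (\<Union>x\<in>X - soft_lower F E X. \<Union>K\<in>soft_Md F E x. K)"

text \<open>The subfamily \<open>\<A>\<close> may be empty, so the empty set is always a finite union.\<close>

definition finite_union_of_members :: "'a set set \<Rightarrow> 'a set \<Rightarrow> bool" where
  "finite_union_of_members C A \<longleftrightarrow> (\<exists>\<A>. finite \<A> \<and> \<A> \<subseteq> C \<and> A = \<Union>\<A>)"

end

theory Submission
  imports Defs
begin

text \<open>
  Condition (ii) says that any two members of the cover through a point \<open>x\<close> contain a common
  member through \<open>x\<close>, equivalently that \<open>x\<close> has exactly one minimal member \<open>N x\<close>. In that case
  the upper approximation of \<open>X\<close> is \<open>\<Union>x\<in>X. N x\<close>, which is additive. Conversely, additivity makes
  the upper approximation monotone, so for a minimal member \<open>K\<close> through \<open>x\<close> the upper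
  approximation of \<open>{x}\<close> lies inside that of \<open>K\<close>, which is \<open>K\<close> itself; hence every other minimal
  member through \<open>x\<close> is contained in \<open>K\<close>.
\<close>

lemma soft_Md_iff:
  "K \<in> soft_Md F E x \<longleftrightarrow>
     K \<in> F ` E \<and> x \<in> K \<and> (\<forall>a\<in>E. x \<in> F a \<and> F a \<subseteq> K \<longrightarrow> F a = K)"
  by (auto simp: soft_Md_def)

lemma soft_Md_below:
  assumes "finite E" "a \<in> E" "x \<in> F a"
  obtains K where "K \<in> soft_Md F E x" "K \<subseteq> F a"
proof -
  let ?A = "{K \<in> F ` E. x \<in> K}"
  have "finite ?A" "F a \<in> ?A" using assms by auto
  then obtain K where "K \<in> ?A" "K \<subseteq> F a" "\<forall>L\<in>?A. L \<subseteq> K \<longrightarrow> K = L"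
    using finite_has_minimal2[of ?A "F a"] by blast
  then show thesis by (intro that[of K]) (auto simp: soft_Md_iff)
qed

lemma soft_lower_member: "e \<in> E \<Longrightarrow> soft_lower F E (F e) = F e"
  by (auto simp: soft_lower_def)

lemma soft_upper_member: "e \<in> E \<Longrightarrow> soft_upper F E (F e) = F e"
  by (simp add: soft_upper_def soft_lower_member)

text \<open>For the converse take all members contained in \<open>A\<close>, a finite family because
  \<open>E\<close> is finite. This makes (ii) a pointwise condition.\<close>

lemma finite_union_of_members_iff:
  assumes "finite E"
  shows "finite_union_of_members (soft_cover F E) A \<longleftrightarrow> (\<forall>x\<in>A. \<exists>e\<in>E. x \<in> F e \<and> F e \<subseteq> A)"
    (is "?L \<longleftrightarrow> ?R")
proof
  assume ?L
  then show ?R unfolding finite_union_of_members_def soft_cover_def by blast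
next
  assume ?R
  then have "A = \<Union>{K \<in> F ` E. K \<subseteq> A}" by blast
  moreover have "finite {K \<in> F ` E. K \<subseteq> A}" using assms by simp
  moreover have "{K \<in> F ` E. K \<subseteq> A} \<subseteq> soft_cover F E" by (auto simp: soft_cover_def)
  ultimately show ?L unfolding finite_union_of_members_def by blast
qed

text \<open>By \<open>least\<close>, the minimal members through a point of the lower approximation
  stay inside it, so the union may run over all of \<open>X\<close>.\<close>

lemma soft_upper_eq_Union_Md:
  assumes "finite E"
    and least: "\<And>x K a. K \<in> soft_Md F E x \<Longrightarrow> a \<in> E \<Longrightarrow> x \<in> F a \<Longrightarrow> K \<subseteq> F a"
  shows "soft_upper F E X = (\<Union>x\<in>X. \<Union>(soft_Md F E x))"
proof
  have "soft_lower F E X \<subseteq> (\<Union>x\<in>X. \<Union>(soft_Md F E x))"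
  proof
    fix x assume "x \<in> soft_lower F E X"
    then obtain e where e: "e \<in> E" "x \<in> F e" "F e \<subseteq> X" by (auto simp: soft_lower_def)
    obtain K where "K \<in> soft_Md F E x" using soft_Md_below[where F = F, OF assms(1) e(1,2)] by blast
    moreover from this have "x \<in> K" by (simp add: soft_Md_iff)
    ultimately show "x \<in> (\<Union>x\<in>X. \<Union>(soft_Md F E x))" using e by blast
  qed
  then show "soft_upper F E X \<subseteq> (\<Union>x\<in>X. \<Union>(soft_Md F E x))"
    by (auto simp: soft_upper_def)
  have "\<Union>(soft_Md F E x) \<subseteq> soft_lower F E X" if "x \<in> soft_lower F E X" for x
    using that least unfolding soft_lower_def by blast
  then show "(\<Union>x\<in>X. \<Union>(soft_Md F E x)) \<subseteq> soft_upper F E X"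
    unfolding soft_upper_def by blast
qed

lemma soft_Md_unique:
  assumes mono: "\<And>X Y. X \<subseteq> Y \<Longrightarrow> Y \<subseteq> \<Union>(F ` E) \<Longrightarrow> soft_upper F E X \<subseteq> soft_upper F E Y"
    and K: "K \<in> soft_Md F E x" and L: "L \<in> soft_Md F E x"
  shows "L = K"
\<comment> \<open>If \<open>{x}\<close> is a member, its upper approximation ignores the minimal
  description of \<open>x\<close>, but \<open>{x}\<close> is then the only minimal member through
  \<open>x\<close>.\<close>
proof (cases "{x} \<in> F ` E")
  case True
  then have "M = {x}" if "M \<in> soft_Md F E x" for M
    using that by (fastforce simp: soft_Md_iff)
  then show ?thesis using K L by blast
next
  case False
  obtain e where e: "e \<in> E" "K = F e" "x \<in> F e" using K by (auto simp: soft_Md_iff)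
  \<comment> \<open>A member inside \<open>{x}\<close> could only be empty, so \<open>x\<close>
    stays in the index set of the upper approximation.\<close>
  have "x \<notin> soft_lower F E {x}"
    using False by (auto simp: soft_lower_def subset_singleton_iff)
  then have "L \<subseteq> soft_upper F E {x}" using L by (auto simp: soft_upper_def)
  also have "\<dots> \<subseteq> soft_upper F E K" using e by (intro mono) auto
  also have "\<dots> = K" using e soft_upper_member by metis
  finally show ?thesis using K L by (auto simp: soft_Md_iff)
qed

theorem corollary23:
  fixes U :: "'a set" and E :: "'e set" and F :: "'e \<Rightarrow> 'a set"
  assumes "finite E"
    and "covering_soft_set U F E"
  shows "(\<forall>X Y. X \<subseteq> U \<and> Y \<subseteq> U \<longrightarrow>
            soft_upper F E (X \<union> Y) = soft_upper F E X \<union> soft_upper F E Y)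
     \<longleftrightarrow> (\<forall>e1\<in>E. \<forall>e2\<in>E. finite_union_of_members (soft_cover F E) (F e1 \<inter> F e2))"
    (is "?additive \<longleftrightarrow> ?inter")
proof
  assume additive: ?additive
  have U: "\<Union>(F ` E) = U" using assms(2) by (simp add: covering_soft_set_def)
  have mono: "soft_upper F E X \<subseteq> soft_upper F E Y" if "X \<subseteq> Y" "Y \<subseteq> \<Union>(F ` E)" for X Y
  proof -
    have "soft_upper F E (X \<union> Y) = soft_upper F E X \<union> soft_upper F E Y"
      using additive that U by blast
    then show ?thesis using that(1) by (metis Un_absorb1 Un_upper1)
  qed
  show ?inter
    unfolding finite_union_of_members_iff[OF assms(1)]
  proof (intro ballI)
    fix e1 e2 x assume e: "e1 \<in> E" "e2 \<in> E" and x: "x \<in> F e1 \<inter> F e2"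
    obtain K where K: "K \<in> soft_Md F E x" "K \<subseteq> F e1"
      using soft_Md_below[where F = F, OF assms(1) e(1)] x by blast
    obtain L where L: "L \<in> soft_Md F E x" "L \<subseteq> F e2"
      using soft_Md_below[where F = F, OF assms(1) e(2)] x by blast
    have "L = K" using mono K(1) L(1) by (rule soft_Md_unique)
    then show "\<exists>e\<in>E. x \<in> F e \<and> F e \<subseteq> F e1 \<inter> F e2"
      using K L by (auto simp: soft_Md_iff)
  qed
next
  assume inter: ?inter
  \<comment> \<open>By (ii) some member through \<open>x\<close> lies inside
    \<open>K \<inter> F a\<close>; minimality of \<open>K\<close> makes it equal to
    \<open>K\<close>.\<close>
  have "K \<subseteq> F a" if K: "K \<in> soft_Md F E x" and a: "a \<in> E" "x \<in> F a" for x K a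
  proof -
    obtain e where e: "e \<in> E" "K = F e" "x \<in> F e" using K by (auto simp: soft_Md_iff)
    then obtain b where "b \<in> E" "x \<in> F b" "F b \<subseteq> F e \<inter> F a"
      using inter a unfolding finite_union_of_members_iff[OF assms(1)] by blast
    then show ?thesis using K e by (auto simp: soft_Md_iff)
  qed
  from soft_upper_eq_Union_Md[OF assms(1) this] show ?additive
    by simp
qed

end
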